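(* Let $\pi=r_1\ldots r_k$ be a fixed sequence of $k$ nonnegative integers, at least one of which is positive, and let $|\pi|=\sum_{i=1}^k r_i$. Then for any positive constant $\alpha$, as $n\to\infty$, $$\mathbb{P}\big[\mathbf{C}_{n,p}\text{ contains the exact consecutive pattern }\pi\big]\to\begin{cases}0,&\text{if } p\ll n^{-1/|\pi|},\\ 1-e^{-\alpha^{|\pi|}},&\text{if } p\sim\alpha n^{-1/|\pi|},\\ 1,&\text{if } n^{-1/|\pi|}\ll p\text{ and } q\gg n^{-1/k},\\ 1-e^{-\alpha^k},&\text{if } q\sim\alpha n^{-1/k},\\ 0,&\text{if } n^{-1/k}\gg q.\end{cases}$$ Moreover, the expected number of occurrences of the exact consecutive pattern $\pi$ in $\mathbf{C}_{n,p}$ is maximal when $p/q=|\pi|/k$.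
   Context: An $n$-composition is a sequence of $n$ nonnegative integers. For $p=p(n)\in[0,1)$ and $q=1-p$, the geometric random composition $\mathbf{C}_{n,p}$ is the random $n$-composition whose terms are independent, with $\mathbb{P}[\mathbf{C}_{n,p}(i)=j]=qp^j$ for every $j\ge0$ and $i\in\{1,\dots,n\}$. The exact consecutive pattern $r_1\ldots r_k$ occurs at position $i$ in a composition $C$ if $C(i-1+j)=r_j$ for each $j\in\{1,\dots,k\}$; $C$ contains the pattern if it occurs at some position. For positive functions of $n$: $f\ll g$ (or $g\gg f$) means $\lim_{n\to\infty} f/g=0$, and $f\sim g$ means $\lim_{n\to\infty} f/g=1$. *)

theory Defs
  imports "HOL-Probability.Probability" "HOL-Library.Landau_Symbols"
begin

text \<open>
  An \<open>n\<close>-composition is a function \<open>C :: nat \<Rightarrow> nat\<close> of which only the values \<open>C 1, \<dots>, C n\<close>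
  matter. Under the distribution below the values outside \<open>{1..n}\<close> are the dummy \<open>0\<close>; the bound
  \<open>i - 1 + length r \<le> n\<close> in \<open>occurs_at\<close> ensures that these are never inspected.
\<close>

text \<open>
  \<open>geometric_pmf q\<close> is parametrised by the success probability and has mass \<open>(1 - q) ^ j * q\<close>
  at \<open>j\<close>, so the terms have mass \<open>(1 - p) * p ^ j\<close> for \<open>p \<in> [0, 1)\<close>.
\<close>
definition geometric_composition :: "nat \<Rightarrow> real \<Rightarrow> (nat \<Rightarrow> nat) pmf" where
  "geometric_composition n p = Pi_pmf {1..n} 0 (\<lambda>_. geometric_pmf (1 - p))"

text \<open>The pattern \<open>r\<^sub>1\<dots>r\<^sub>k\<close> is the list \<open>r\<close>, with \<open>r\<^sub>j = r ! (j - 1)\<close>.\<close>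
definition occurs_at :: "nat \<Rightarrow> nat list \<Rightarrow> (nat \<Rightarrow> nat) \<Rightarrow> nat \<Rightarrow> bool" where
  "occurs_at n r C i \<longleftrightarrow>
     1 \<le> i \<and> i - 1 + length r \<le> n \<and> (\<forall>j\<in>{1..length r}. C (i - 1 + j) = r ! (j - 1))"

definition contains_pattern :: "nat \<Rightarrow> nat list \<Rightarrow> (nat \<Rightarrow> nat) \<Rightarrow> bool" where
  "contains_pattern n r C \<longleftrightarrow> (\<exists>i. occurs_at n r C i)"

definition num_occurrences :: "nat \<Rightarrow> nat list \<Rightarrow> (nat \<Rightarrow> nat) \<Rightarrow> nat" where
  "num_occurrences n r C = card {i. occurs_at n r C i}"

definition prob_contains :: "nat \<Rightarrow> nat list \<Rightarrow> real \<Rightarrow> real" where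
  "prob_contains n r p =
     measure_pmf.prob (geometric_composition n p) {C. contains_pattern n r C}"

definition expected_occurrences :: "nat \<Rightarrow> nat list \<Rightarrow> real \<Rightarrow> real" where
  "expected_occurrences n r p =
     measure_pmf.expectation (geometric_composition n p) (\<lambda>C. real (num_occurrences n r C))"

end

theory Submission
  imports Defs
begin

text \<open>
  Write \<open>k\<close> for the length of \<open>r\<close>, \<open>m\<close> for its sum, \<open>q = 1 - p\<close>, and \<open>x = q ^ k * p ^ m\<close> for the
  probability of an occurrence at a given position. The expected number of occurrences is
  \<open>(n + 1 - k) * x\<close> for \<open>n \<ge> k\<close>, and weighted AM--GM (\<open>power_mult_power_le_maximum\<close>) places its
  maximum at \<open>p / q = m / k\<close>.

  Let \<open>a t\<close> be the probability that no occurrence lies within the first \<open>t\<close> terms. If occurrences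
  were independent, \<open>a\<close> would shrink by the factor \<open>1 - x\<close> with each new term. Dependence arises only
  between windows that overlap. The key point is that, because \<open>r\<close> has a positive entry, two
  overlapping occurrences together have probability at most \<open>x * (p * q)\<close>
  (\<open>prob_two_matches_le\<close>). Hence \<open>a (t + 1)\<close> differs from \<open>(1 - x) * a t\<close> by at most
  \<open>k * x * (x + p * q)\<close> (\<open>a_step_approx\<close>), and after \<open>n\<close> steps \<open>a n\<close> differs from
  \<open>(1 - x) ^ (n + 1 - k)\<close> by at most \<open>n\<close> times that (\<open>a_approx\<close>). If \<open>n * x \<longlonglongrightarrow> l\<close> and
  \<open>p * q \<longlonglongrightarrow> 0\<close>, the error vanishes and the probability of containing \<open>r\<close> tends to
  \<open>1 - exp (- l)\<close>. This elementary recursion replaces general Poisson approximation.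

  When \<open>p\<close> is of order at most \<open>n powr (- 1 / m)\<close>, it tends to \<open>0\<close> and \<open>n * x\<close> behaves like
  \<open>n * p ^ m\<close>; when \<open>q\<close> is of order at most \<open>n powr (- 1 / k)\<close>, it tends to \<open>0\<close> and \<open>n * x\<close>
  behaves like \<open>n * q ^ k\<close>. The limits \<open>0\<close> are thus the case \<open>l = 0\<close> of the two Poisson limits.
  In the middle range \<open>n * x\<close> tends to infinity and \<open>p * q\<close> need not be small, but there the
  \<open>n div k\<close> disjoint windows, which are independent, already force \<open>a n \<longlonglongrightarrow> 0\<close> (\<open>a_le_exp\<close>).
\<close>

section \<open>Independence and cylinders in product distributions\<close>

lemma prob_Pi_pmf_Int_indep:
  assumes fin: "finite S" and A: "A \<subseteq> S"
    and X: "\<And>f g. (\<And>x. x \<in> A \<Longrightarrow> f x = g x) \<Longrightarrow> f \<in> X \<longleftrightarrow> g \<in> X"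
    and Y: "\<And>f g. (\<And>x. x \<in> S - A \<Longrightarrow> f x = g x) \<Longrightarrow> f \<in> Y \<longleftrightarrow> g \<in> Y"
  shows "measure_pmf.prob (Pi_pmf S d D) (X \<inter> Y) =
         measure_pmf.prob (Pi_pmf S d D) X * measure_pmf.prob (Pi_pmf S d D) Y"
proof -
  define M where "M = Pi_pmf A d D"
  define N where "N = Pi_pmf (S - A) d D"
  define h where "h = (\<lambda>(f, g) x. if x \<in> A then f x else (g x :: 'b))"
  have finA: "finite A" "finite (S - A)"
    using fin A by (auto intro: finite_subset)
  have S: "S = A \<union> (S - A)"
    using A by blast
  have eq: "Pi_pmf S d D = map_pmf h (pair_pmf M N)"
    unfolding M_def N_def h_def using finA by (subst S, subst Pi_pmf_union) auto
  have hX: "h (f, g) \<in> X \<longleftrightarrow> f \<in> X" for f g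
    by (rule X) (simp add: h_def)
  have hY: "h (f, g) \<in> Y \<longleftrightarrow> g \<in> Y" for f g
    by (rule Y) (simp add: h_def)
  have prob_times: "measure_pmf.prob (pair_pmf M N) (U \<times> V) =
      measure_pmf.prob M U * measure_pmf.prob N V" for U V
  proof -
    \<comment> \<open>Intersecting with the countable supports makes the product rule for countable events
        applicable.\<close>
    have "measure_pmf.prob (pair_pmf M N) (U \<times> V) =
        measure_pmf.prob (pair_pmf M N) ((U \<inter> set_pmf M) \<times> (V \<inter> set_pmf N))"
      by (subst measure_Int_set_pmf [symmetric]) (simp add: Times_Int_Times)
    also have "\<dots> = measure_pmf.prob M (U \<inter> set_pmf M) * measure_pmf.prob N (V \<inter> set_pmf N)"
      by (intro measure_pmf_prob_product countable_Int2 countable_set_pmf)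
    finally show ?thesis
      by (simp add: measure_Int_set_pmf)
  qed
  have "h -` (X \<inter> Y) = X \<times> Y" "h -` X = X \<times> UNIV" "h -` Y = UNIV \<times> Y"
    using hX hY by auto
  then show ?thesis
    by (simp add: eq prob_times)
qed

lemma prob_geometric_composition_cylinder:
  assumes J: "J \<subseteq> {1..n}" and p: "0 \<le> p" "p < 1"
  shows "measure_pmf.prob (geometric_composition n p) {C. \<forall>j\<in>J. C j = v j} =
         (\<Prod>j\<in>J. (1 - p) * p ^ v j)"
proof -
  define B where "B j = (if j \<in> J then {v j} else UNIV)" for j
  have "{C. \<forall>j\<in>J. C j = v j} = Pi {1..n} B"
    using J by (auto simp: B_def Pi_def)
  then have "measure_pmf.prob (geometric_composition n p) {C. \<forall>j\<in>J. C j = v j} =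
      (\<Prod>j\<in>{1..n}. measure_pmf.prob (geometric_pmf (1 - p)) (B j))"
    by (simp add: geometric_composition_def measure_Pi_pmf_Pi)
  also have "\<dots> = (\<Prod>j\<in>{1..n}. if j \<in> J then (1 - p) * p ^ v j else 1)"
    using p by (intro prod.cong) (auto simp: B_def measure_pmf_single)
  also have "\<dots> = (\<Prod>j\<in>J. (1 - p) * p ^ v j)"
    using J by (subst prod.inter_restrict [symmetric]) (auto simp: Int_absorb1)
  finally show ?thesis .
qed

section \<open>Occurrences in a geometric composition\<close>

text \<open>
  Occurrences are indexed by the number \<open>s\<close> of terms before them, and without a bound by the total
  length, so that the same event can be used with every prefix length \<open>t\<close> in \<open>avoids\<close>.
\<close>
definition matches :: "nat list \<Rightarrow> nat \<Rightarrow> (nat \<Rightarrow> nat) set" where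
  "matches r s = {C. \<forall>j<length r. C (Suc (s + j)) = r ! j}"

definition avoids :: "nat list \<Rightarrow> nat \<Rightarrow> (nat \<Rightarrow> nat) set" where
  "avoids r t = {C. \<not> contains_pattern t r C}"

lemma occurs_at_Suc: "occurs_at n r C (Suc s) \<longleftrightarrow> s + length r \<le> n \<and> C \<in> matches r s"
proof -
  have "(\<forall>j\<in>{1..length r}. C (s + j) = r ! (j - 1)) \<longleftrightarrow> (\<forall>j<length r. C (Suc (s + j)) = r ! j)"
    (is "?L \<longleftrightarrow> ?R")
  proof
    assume L: ?L
    show ?R
    proof (intro allI impI)
      fix j assume "j < length r"
      then show "C (Suc (s + j)) = r ! j"
        using bspec [OF L, of "Suc j"] by simp
    qed
  next
    assume R: ?R
    show ?L
    proof
      fix j assume "j \<in> {1..length r}"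
      then show "C (s + j) = r ! (j - 1)"
        using R by (cases j) auto
    qed
  qed
  then show ?thesis
    by (simp add: occurs_at_def matches_def)
qed

lemma contains_pattern_iff:
  "contains_pattern t r C \<longleftrightarrow> (\<exists>s. s + length r \<le> t \<and> C \<in> matches r s)"
proof -
  have "contains_pattern t r C \<longleftrightarrow> (\<exists>s. occurs_at t r C (Suc s))"
    unfolding contains_pattern_def
    by (metis One_nat_def Suc_le_D occurs_at_def)
  then show ?thesis
    by (simp add: occurs_at_Suc)
qed

lemma in_avoids_iff: "C \<in> avoids r t \<longleftrightarrow> (\<forall>s. s + length r \<le> t \<longrightarrow> C \<notin> matches r s)"
  by (auto simp: avoids_def contains_pattern_iff)

lemma matches_cong:
  assumes "\<And>j. j \<in> {Suc s..s + length r} \<Longrightarrow> C j = C' j"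
  shows "C \<in> matches r s \<longleftrightarrow> C' \<in> matches r s"
  using assms by (auto simp: matches_def)

lemma avoids_cong:
  assumes "\<And>j. j \<in> {1..t} \<Longrightarrow> C j = C' j"
  shows "C \<in> avoids r t \<longleftrightarrow> C' \<in> avoids r t"
proof -
  have "C \<in> matches r s \<longleftrightarrow> C' \<in> matches r s" if "s + length r \<le> t" for s
    by (rule matches_cong) (use that in \<open>auto intro!: assms\<close>)
  then show ?thesis
    by (auto simp: in_avoids_iff)
qed

locale geometric_pattern =
  fixes n :: nat and p :: real and r :: "nat list"
  assumes p_nonneg: "0 \<le> p" and p_less_1: "p < 1"
    and positive_entry: "\<exists>a\<in>set r. a > 0"
begin

abbreviation k :: nat where "k \<equiv> length r"

abbreviation P :: "(nat \<Rightarrow> nat) set \<Rightarrow> real" where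
  "P \<equiv> measure_pmf.prob (geometric_composition n p)"

definition x :: real where "x = (1 - p) ^ k * p ^ sum_list r"

lemma k_pos: "k > 0"
  using positive_entry by (cases r) auto

lemma x_bounds: "0 \<le> x" "x \<le> 1"
  using p_nonneg p_less_1 by (auto simp: x_def intro!: mult_le_one power_le_one)

lemma prod_match: "(\<Prod>j\<in>{Suc s..s + k}. (1 - p) * p ^ (r ! (j - Suc s))) = x"
proof -
  have "(\<Prod>j\<in>{Suc s..s + k}. (1 - p) * p ^ (r ! (j - Suc s))) = (\<Prod>j<k. (1 - p) * p ^ (r ! j))"
    by (rule prod.reindex_bij_witness [of _ "\<lambda>j. Suc (s + j)" "\<lambda>j. j - Suc s"]) auto
  also have "\<dots> = x"
    by (simp add: x_def prod.distrib power_sum [symmetric] sum_list_sum_nth atLeast0LessThan)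
  finally show ?thesis .
qed

lemma matches_eq_cylinder: "matches r s = {C. \<forall>j\<in>{Suc s..s + k}. C j = r ! (j - Suc s)}"
proof (intro set_eqI iffI)
  fix C assume "C \<in> {C. \<forall>j\<in>{Suc s..s + k}. C j = r ! (j - Suc s)}"
  then have "C (Suc (s + j)) = r ! (Suc (s + j) - Suc s)" if "j < k" for j
    using that by (intro bspec [where x = "Suc (s + j)"]) auto
  then show "C \<in> matches r s"
    by (simp add: matches_def)
next
  fix C assume C: "C \<in> matches r s"
  have "C j = r ! (j - Suc s)" if "j \<in> {Suc s..s + k}" for j
  proof -
    have "j - Suc s < k"
      using that k_pos by auto
    then have "C (Suc (s + (j - Suc s))) = r ! (j - Suc s)"
      using C by (simp add: matches_def)
    then show ?thesis
      using that by simp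
  qed
  then show "C \<in> {C. \<forall>j\<in>{Suc s..s + k}. C j = r ! (j - Suc s)}"
    by simp
qed

lemma prob_matches:
  assumes "s + k \<le> n"
  shows "P (matches r s) = x"
  unfolding matches_eq_cylinder
  using assms p_nonneg p_less_1
  by (subst prob_geometric_composition_cylinder) (auto simp: prod_match)

text \<open>
  Two overlapping occurrences cost an extra factor. The last positive entry of \<open>r\<close>, as seen from
  the later copy, must lie beyond the end of the earlier copy: inside it, it would exhibit a
  positive entry of \<open>r\<close> at a larger index. So besides the earlier copy the composition has a
  further term with a prescribed positive value \<open>v\<close>, of probability
  \<open>(1 - p) * p ^ v \<le> (1 - p) * p\<close>. This is small when \<open>p\<close> tends to \<open>0\<close> and also when it tends
  to \<open>1\<close>.
\<close>
lemma prob_two_matches_le: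
  assumes d: "d > 0" and sd: "s + d + k \<le> n"
  shows "P (matches r s \<inter> matches r (s + d)) \<le> x * (p * (1 - p))"
proof -
  let ?Q = "\<lambda>i. i < k \<and> r ! i > 0"
  have ex: "\<exists>i. ?Q i"
    using positive_entry by (metis in_set_conv_nth)
  define i where "i = (GREATEST i. ?Q i)"
  have i: "i < k" "r ! i > 0"
    using GreatestI_ex_nat [of ?Q k] ex by (auto simp: i_def)
  have max: "j \<le> i" if "?Q j" for j
    unfolding i_def using that by (intro Greatest_le_nat [of ?Q j k]) auto
  have bound_nonneg: "0 \<le> x * (p * (1 - p))"
    using x_bounds p_nonneg p_less_1 by simp
  show ?thesis
  proof (cases "d + i < k")
    case True
    have "matches r s \<inter> matches r (s + d) = {}"
    proof (rule ccontr)
      assume "matches r s \<inter> matches r (s + d) \<noteq> {}"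
      then obtain C where C: "C \<in> matches r s" "C \<in> matches r (s + d)"
        by blast
      have "r ! (d + i) = C (Suc (s + (d + i)))"
        using C(1) True by (simp add: matches_def)
      also have "\<dots> = r ! i"
        using C(2) i(1) by (simp add: matches_def add.assoc)
      finally have "?Q (d + i)"
        using True i by simp
      then show False
        using max d by fastforce
    qed
    then show ?thesis
      using bound_nonneg by simp
  next
    case False
    define t where "t = Suc (s + d + i)"
    define v where "v j = (if j = t then r ! i else r ! (j - Suc s))" for j
    let ?W = "{Suc s..s + k}"
    have t: "t \<notin> ?W" "t \<in> {1..n}"
      using False i sd by (auto simp: t_def)
    have "C j = v j" if "C \<in> matches r s" "C \<in> matches r (s + d)" "j \<in> insert t ?W" for C j
      using that i t(1) unfolding matches_eq_cylinder [of s]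
      by (auto simp: v_def t_def matches_def)
    then have "P (matches r s \<inter> matches r (s + d)) \<le> P {C. \<forall>j\<in>insert t ?W. C j = v j}"
      by (intro measure_pmf.finite_measure_mono) auto
    also have "\<dots> = (\<Prod>j\<in>insert t ?W. (1 - p) * p ^ v j)"
      using t sd p_nonneg p_less_1
      by (intro prob_geometric_composition_cylinder) auto
    also have "\<dots> = (1 - p) * p ^ (r ! i) * (\<Prod>j\<in>?W. (1 - p) * p ^ v j)"
      using t by (subst prod.insert) (auto simp: v_def)
    also have "(\<Prod>j\<in>?W. (1 - p) * p ^ v j) = x"
      using t(1) by (subst prod_match [of s, symmetric], intro prod.cong) (auto simp: v_def)
    also have "(1 - p) * p ^ (r ! i) * x \<le> (1 - p) * p * x"
      using power_decreasing [of 1 "r ! i" p] i(2) p_nonneg p_less_1 x_bounds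
      by (intro mult_right_mono mult_left_mono) auto
    finally show ?thesis
      by (simp add: mult_ac)
  qed
qed

definition a :: "nat \<Rightarrow> real" where "a t = P (avoids r t)"

lemma a_nonneg: "0 \<le> a t"
  by (simp add: a_def)

lemma a_eq_1:
  assumes "t < k"
  shows "a t = 1"
proof -
  have "avoids r t = UNIV"
    using assms by (auto simp: in_avoids_iff)
  then show ?thesis
    by (simp add: a_def)
qed

lemma a_mono: "s \<le> t \<Longrightarrow> a t \<le> a s"
  unfolding a_def by (intro measure_pmf.finite_measure_mono) (auto simp: in_avoids_iff)

lemma prob_avoids_Int_matches:
  assumes "s + k \<le> n"
  shows "P (avoids r s \<inter> matches r s) = a s * x"
proof -
  have "P (avoids r s \<inter> matches r s) = P (avoids r s) * P (matches r s)"
    unfolding geometric_composition_def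
  proof (rule prob_Pi_pmf_Int_indep [where A = "{1..s}"])
    show "f \<in> avoids r s \<longleftrightarrow> g \<in> avoids r s"
      if "\<And>x. x \<in> {1..s} \<Longrightarrow> f x = g x" for f g
      using that by (rule avoids_cong)
    show "f \<in> matches r s \<longleftrightarrow> g \<in> matches r s"
      if "\<And>x. x \<in> {1..n} - {1..s} \<Longrightarrow> f x = g x" for f g
      by (rule matches_cong) (use that assms in auto)
  qed (use assms in auto)
  then show ?thesis
    using assms by (simp add: prob_matches a_def)
qed

text \<open>
  Lengthening the composition from \<open>t\<close> to \<open>t + 1 = s + k\<close> terms adds just the occurrence that
  starts after the first \<open>s\<close> terms.
\<close>
lemma a_step:
  assumes "Suc t = s + k"
  shows "a (Suc t) = a t - P (avoids r t \<inter> matches r s)"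
proof -
  have "s' + k \<le> Suc t \<longleftrightarrow> s' + k \<le> t \<or> s' = s" for s'
    using assms by auto
  then have "avoids r (Suc t) = avoids r t - avoids r t \<inter> matches r s"
    by (auto simp: in_avoids_iff)
  then show ?thesis
    unfolding a_def by (simp add: measure_pmf.finite_measure_Diff)
qed

lemma a_step_lower:
  assumes t: "Suc t = s + k" "Suc t \<le> n"
  shows "a t - a s * x \<le> a (Suc t)"
proof -
  have st: "s \<le> t"
    using t k_pos by linarith
  have "P (avoids r t \<inter> matches r s) \<le> P (avoids r s \<inter> matches r s)"
    using st by (intro measure_pmf.finite_measure_mono) (auto simp: in_avoids_iff)
  then show ?thesis
    using a_step [OF t(1)] prob_avoids_Int_matches [of s] t by simp
qed

text \<open>
  A composition that avoids \<open>r\<close> in the first \<open>s\<close> terms but not in the first \<open>t\<close>, and matches it in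
  the last window, has an earlier occurrence overlapping that window. There are fewer than \<open>k\<close>
  positions for it.
\<close>
lemma a_step_upper:
  assumes t: "Suc t = s + k" "Suc t \<le> n"
  shows "a (Suc t) \<le> a t - a s * x + k * (x * (p * (1 - p)))"
proof -
  let ?I = "{Suc s - k..<s}"
  let ?U = "\<Union>s'\<in>?I. matches r s' \<inter> matches r s"
  have sub: "avoids r s \<inter> matches r s \<subseteq> (avoids r t \<inter> matches r s) \<union> ?U"
  proof
    fix C assume C: "C \<in> avoids r s \<inter> matches r s"
    show "C \<in> (avoids r t \<inter> matches r s) \<union> ?U"
    proof (cases "C \<in> avoids r t")
      case False
      then obtain s' where s': "s' + k \<le> t" "C \<in> matches r s'"
        by (auto simp: in_avoids_iff)
      moreover have "\<not> s' + k \<le> s"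
        using C s'(2) by (auto simp: in_avoids_iff)
      ultimately have "s' \<in> ?I"
        using t(1) by auto
      then show ?thesis
        using C s'(2) by blast
    qed (use C in simp)
  qed
  have "P ?U \<le> (\<Sum>s'\<in>?I. P (matches r s' \<inter> matches r s))"
    by (rule measure_pmf.finite_measure_subadditive_finite) auto
  also have "\<dots> \<le> (\<Sum>s'\<in>?I. x * (p * (1 - p)))"
  proof (rule sum_mono)
    fix s' assume "s' \<in> ?I"
    then show "P (matches r s' \<inter> matches r s) \<le> x * (p * (1 - p))"
      using prob_two_matches_le [of "s - s'" s'] t by simp
  qed
  also have "\<dots> = card ?I * (x * (p * (1 - p)))"
    by simp
  also have "\<dots> \<le> k * (x * (p * (1 - p)))"
    using x_bounds p_nonneg p_less_1 by (intro mult_right_mono) auto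
  finally have U: "P ?U \<le> k * (x * (p * (1 - p)))" .
  have "a s * x = P (avoids r s \<inter> matches r s)"
    using prob_avoids_Int_matches [of s] t by simp
  also have "\<dots> \<le> P ((avoids r t \<inter> matches r s) \<union> ?U)"
    using sub by (intro measure_pmf.finite_measure_mono) auto
  also have "\<dots> \<le> P (avoids r t \<inter> matches r s) + P ?U"
    by (intro measure_Un_le) auto
  also have "\<dots> \<le> a t - a (Suc t) + k * (x * (p * (1 - p)))"
    using a_step [OF t(1)] U by simp
  finally show ?thesis
    by simp
qed

lemma a_le_1: "a t \<le> 1"
  by (simp add: a_def)

lemma a_decrease_le:
  assumes "s + d \<le> n"
  shows "a s - a (s + d) \<le> d * x"
  using assms
proof (induction d)
  case (Suc d)
  have "a (s + d) - x \<le> a (Suc (s + d))"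
  proof (cases "k \<le> Suc (s + d)")
    case True
    then have "a (s + d) - a (Suc (s + d) - k) * x \<le> a (Suc (s + d))"
      using Suc.prems by (intro a_step_lower) auto
    moreover have "a (Suc (s + d) - k) * x \<le> x"
      using a_le_1 [of "Suc (s + d) - k"] x_bounds by (simp add: mult_left_le_one_le a_nonneg)
    ultimately show ?thesis
      by simp
  qed (use a_eq_1 [of "s + d"] a_eq_1 [of "Suc (s + d)"] x_bounds in simp)
  then show ?case
    using Suc by (simp add: algebra_simps)
qed simp

text \<open>
  The missing independence is that between avoiding \<open>r\<close> in the first \<open>t\<close> terms and matching it at
  the end. Replacing the first event by avoidance in the first \<open>s\<close> terms, which do not meet the
  last window, changes its probability by \<open>k * x\<close> at most. That replacement and the overlapping
  pairs of \<open>a_step_upper\<close> account for the two summands of the error.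
\<close>
lemma a_step_approx:
  assumes t: "k \<le> Suc t" "Suc t \<le> n"
  shows "\<bar>a (Suc t) - (1 - x) * a t\<bar> \<le> k * x * (x + p * (1 - p))"
proof -
  define s where "s = Suc t - k"
  have s: "Suc t = s + k"
    using t by (simp add: s_def)
  have st: "s \<le> t" "t = s + (k - 1)"
    using s k_pos by linarith+
  have "a s - a t \<le> (k - 1) * x"
    using a_decrease_le [of s "k - 1"] st t by simp
  also have "\<dots> \<le> k * x"
    using x_bounds by (intro mult_right_mono) auto
  finally have "(a s - a t) * x \<le> k * x * x"
    using x_bounds by (intro mult_right_mono)
  moreover have "0 \<le> (a s - a t) * x"
    using a_mono [OF st(1)] x_bounds by simp
  moreover have "0 \<le> k * x * x" "0 \<le> k * (x * (p * (1 - p)))"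
    using x_bounds p_nonneg p_less_1 by simp_all
  ultimately show ?thesis
    using a_step_lower [OF s t(2)] a_step_upper [OF s t(2)]
    by (simp add: algebra_simps abs_le_iff)
qed

text \<open>
  The truncated exponent is \<open>0\<close> for \<open>t < k\<close>, where \<open>r\<close> does not yet fit and \<open>a t = 1\<close>. The errors of
  the single steps add up, since multiplication by \<open>1 - x\<close> does not enlarge them.
\<close>
lemma a_approx:
  assumes "t \<le> n"
  shows "\<bar>a t - (1 - x) ^ (Suc t - k)\<bar> \<le> t * (k * x * (x + p * (1 - p)))"
  using assms
proof (induction t)
  case 0
  then show ?case
    using a_eq_1 [of 0] k_pos by (cases k) simp_all
next
  case (Suc t)
  let ?e = "k * x * (x + p * (1 - p))"
  have e: "0 \<le> ?e"
    using x_bounds p_nonneg p_less_1 by simp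
  show ?case
  proof (cases "k \<le> Suc t")
    case True
    let ?w = "(1 - x) ^ (Suc t - k)"
    have w: "(1 - x) ^ (Suc (Suc t) - k) = (1 - x) * ?w"
      using True by (simp add: Suc_diff_le)
    have "\<bar>(1 - x) * (a t - ?w)\<bar> \<le> \<bar>a t - ?w\<bar>"
      using x_bounds by (simp add: abs_mult mult_left_le_one_le)
    then have "\<bar>(1 - x) * a t - (1 - x) * ?w\<bar> \<le> t * ?e"
      using Suc by (simp add: right_diff_distrib)
    with a_step_approx [OF True Suc.prems] show ?thesis
      unfolding w by (simp add: distrib_right)
  next
    case False
    then show ?thesis
      using e a_eq_1 [of "Suc t"] by simp
  qed
qed

text \<open>The windows at multiples of \<open>k\<close> are disjoint, so their matches are independent.\<close>
lemma a_block_le: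
  assumes "j * k \<le> n"
  shows "a (j * k) \<le> (1 - x) ^ j"
  using assms
proof (induction j)
  case 0
  show ?case
    by (simp add: a_le_1)
next
  case (Suc j)
  let ?s = "j * k"
  have "avoids r (Suc j * k) \<subseteq> avoids r ?s - avoids r ?s \<inter> matches r ?s"
    by (auto simp: in_avoids_iff)
  then have "a (Suc j * k) \<le> P (avoids r ?s - avoids r ?s \<inter> matches r ?s)"
    unfolding a_def by (intro measure_pmf.finite_measure_mono) auto
  also have "\<dots> = a ?s - a ?s * x"
    using Suc.prems
    by (simp add: measure_pmf.finite_measure_Diff prob_avoids_Int_matches add.commute flip: a_def)
  also have "\<dots> = (1 - x) * a ?s"
    by (simp add: algebra_simps)
  also have "\<dots> \<le> (1 - x) ^ Suc j"
    using Suc x_bounds by (simp add: mult_left_mono)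
  finally show ?case .
qed

lemma prob_contains_eq: "prob_contains n r p = 1 - a n"
proof -
  have "{C. contains_pattern n r C} = UNIV - avoids r n"
    by (auto simp: avoids_def)
  then show ?thesis
    using measure_pmf.prob_compl [of "avoids r n" "geometric_composition n p"]
    by (simp add: prob_contains_def a_def)
qed

lemma a_le_exp: "a n \<le> exp (1 - n * x / k)"
proof -
  have "real n \<le> real k * (n div k) + k"
    using k_pos mod_less_divisor [of k n] mult_div_mod_eq [of k n]
    by (metis add_left_mono less_imp_le of_nat_add of_nat_le_iff of_nat_mult)
  then have "n / k \<le> n div k + 1"
    using k_pos by (simp add: divide_simps algebra_simps)
  then have "x * (n / k) \<le> x * (n div k + 1)"
    using x_bounds by (intro mult_left_mono)
  then have le: "n * x / k - 1 \<le> (n div k) * x"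
    using x_bounds by (simp add: algebra_simps)
  have "a n \<le> a ((n div k) * k)"
    by (rule a_mono) simp
  also have "\<dots> \<le> (1 - x) ^ (n div k)"
    by (rule a_block_le) simp
  also have "\<dots> \<le> exp (- x) ^ (n div k)"
    using x_bounds exp_ge_add_one_self [of "- x"] by (intro power_mono) auto
  also have "\<dots> = exp (- ((n div k) * x))"
    by (simp add: exp_of_nat_mult [symmetric])
  also have "\<dots> \<le> exp (1 - n * x / k)"
    using le by simp
  finally show ?thesis .
qed

lemma expected_occurrences_eq: "expected_occurrences n r p = (Suc n - k) * x"
proof -
  have num: "real (num_occurrences n r C) = (\<Sum>s<Suc n - k. indicator (matches r s) C)" for C
  proof -
    let ?I = "{s \<in> {..<Suc n - k}. C \<in> matches r s}"
    have "i \<in> {i. occurs_at n r C i} \<longleftrightarrow> i \<in> Suc ` ?I" for i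
    proof (cases i)
      case 0
      then show ?thesis
        by (simp add: occurs_at_def)
    next
      case (Suc s)
      then show ?thesis
        by (auto simp: occurs_at_Suc)
    qed
    then have "{i. occurs_at n r C i} = Suc ` ?I"
      by blast
    then have "real (num_occurrences n r C) = (\<Sum>s\<in>?I. 1)"
      by (simp add: num_occurrences_def card_image)
    also have "\<dots> = (\<Sum>s<Suc n - k. if C \<in> matches r s then 1 else 0)"
      by (rule sum.inter_filter) simp
    finally show ?thesis
      by (simp add: indicator_def of_bool_def)
  qed
  have "expected_occurrences n r p = (\<Sum>s<Suc n - k. P (matches r s))"
    unfolding expected_occurrences_def num
    by (subst Bochner_Integration.integral_sum)
      (auto intro!: integrable_real_indicator simp: less_top [symmetric])
  also have "\<dots> = (\<Sum>s<Suc n - k. x)"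
    by (intro sum.cong prob_matches) auto
  finally show ?thesis
    by simp
qed

end

section \<open>Limits\<close>

text \<open>
  The bases \<open>1 - x n\<close> and \<open>exp (- x n)\<close> lie in the unit interval and differ by
  \<open>x n * x n\<close> at most, so their \<open>N n\<close>-th powers differ by at most \<open>(N n * x n) * x n\<close>, which tends to \<open>l * 0\<close>.
\<close>
lemma one_minus_power_tendsto_exp:
  fixes x :: "nat \<Rightarrow> real" and N :: "nat \<Rightarrow> nat"
  assumes x01: "\<And>n. 0 \<le> x n" "\<And>n. x n \<le> 1" and x0: "x \<longlonglongrightarrow> 0"
    and Nx: "(\<lambda>n. N n * x n) \<longlonglongrightarrow> l"
  shows "(\<lambda>n. (1 - x n) ^ N n) \<longlonglongrightarrow> exp (- l)"
proof -
  have "(\<lambda>n. (1 - x n) ^ N n - exp (- x n) ^ N n) \<longlonglongrightarrow> 0"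
  proof (rule tendsto_0_le [where K = 1 and f = "\<lambda>n. (N n * x n) * x n"])
    show "(\<lambda>n. (N n * x n) * x n) \<longlonglongrightarrow> 0"
      using tendsto_mult [OF Nx x0] by simp
    show "\<forall>\<^sub>F n in sequentially.
        norm ((1 - x n) ^ N n - exp (- x n) ^ N n) \<le> norm ((N n * x n) * x n) * 1"
    proof (rule always_eventually, rule allI)
      fix n
      have "exp (- x n) * (1 + x n) \<le> exp (- x n) * exp (x n)"
        by (intro mult_left_mono exp_ge_add_one_self) auto
      then have "exp (- x n) \<le> 1 / (1 + x n)"
        using x01(1) [of n] by (simp add: field_simps flip: exp_add)
      also have "\<dots> \<le> 1 - x n + x n * x n"
        using x01(1) [of n] by (simp add: field_simps)
      finally have "\<bar>(1 - x n) - exp (- x n)\<bar> \<le> x n * x n"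
        using exp_ge_add_one_self [of "- x n"] by (simp add: abs_le_iff)
      moreover have "norm ((1 - x n) ^ N n - exp (- x n) ^ N n) \<le>
          N n * norm ((1 - x n) - exp (- x n))"
        using x01 [of n] by (intro norm_power_diff) auto
      ultimately have "norm ((1 - x n) ^ N n - exp (- x n) ^ N n) \<le> N n * (x n * x n)"
        by (smt (verit, best) mult_left_mono of_nat_0_le_iff real_norm_def)
      then show "norm ((1 - x n) ^ N n - exp (- x n) ^ N n) \<le> norm ((N n * x n) * x n) * 1"
        using x01(1) [of n] by (simp add: mult_ac)
    qed
  qed
  moreover have "(\<lambda>n. exp (- x n) ^ N n) \<longlonglongrightarrow> exp (- l)"
    using tendsto_exp [OF tendsto_minus [OF Nx]] by (simp add: exp_of_nat_mult [symmetric])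
  ultimately have "(\<lambda>n. ((1 - x n) ^ N n - exp (- x n) ^ N n) + exp (- x n) ^ N n)
      \<longlonglongrightarrow> 0 + exp (- l)"
    by (rule tendsto_add)
  then show ?thesis
    by simp
qed

lemma tendsto_0_if_scaled_convergent:
  fixes f :: "nat \<Rightarrow> real"
  assumes "(\<lambda>n. n * f n) \<longlonglongrightarrow> l"
  shows "f \<longlonglongrightarrow> 0"
proof -
  have "(\<lambda>n. (n * f n) * inverse (real n)) \<longlonglongrightarrow> l * 0"
    by (intro tendsto_mult assms lim_inverse_n)
  moreover have "\<forall>\<^sub>F n in sequentially. (n * f n) * inverse (real n) = f n"
    using eventually_gt_at_top [of 0] by eventually_elim simp
  ultimately show ?thesis
    by (simp add: tendsto_cong)
qed

text \<open>
  Both Poisson limits and both vanishing limits are instances: \<open>l\<close> is the limit of the expected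
  number of occurrences, and \<open>p n * (1 - p n)\<close> tends to \<open>0\<close> at either end of the range of \<open>p\<close>.
\<close>
lemma prob_contains_poisson_limit:
  fixes p :: "nat \<Rightarrow> real"
  assumes pos: "\<exists>a\<in>set r. a > 0" and p: "\<And>n. 0 \<le> p n \<and> p n < 1"
    and pq: "(\<lambda>n. p n * (1 - p n)) \<longlonglongrightarrow> 0"
    and l: "(\<lambda>n. n * ((1 - p n) ^ length r * p n ^ sum_list r)) \<longlonglongrightarrow> l"
  shows "(\<lambda>n. prob_contains n r (p n)) \<longlonglongrightarrow> 1 - exp (- l)"
proof -
  interpret geometric_pattern n "p n" r for n
    using pos p by unfold_locales auto
  let ?x = x and ?k = "length r"
  let ?N = "\<lambda>n. Suc n - ?k"
  have nx: "(\<lambda>n. n * ?x n) \<longlonglongrightarrow> l"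
    using l by (simp add: x_def)
  then have x0: "?x \<longlonglongrightarrow> 0"
    by (rule tendsto_0_if_scaled_convergent)
  have "(\<lambda>n. n * ?x n + (1 - real ?k) * ?x n) \<longlonglongrightarrow> l + (1 - real ?k) * 0"
    by (intro tendsto_intros nx x0)
  moreover have "\<forall>\<^sub>F n in sequentially. n * ?x n + (1 - real ?k) * ?x n = ?N n * ?x n"
    using eventually_ge_at_top [of ?k] by eventually_elim (simp add: algebra_simps of_nat_diff)
  ultimately have Nx: "(\<lambda>n. ?N n * ?x n) \<longlonglongrightarrow> l"
    by (simp add: tendsto_cong)
  have "(\<lambda>n. a n n - (1 - ?x n) ^ ?N n) \<longlonglongrightarrow> 0"
  proof (rule tendsto_0_le [where K = 1 and f = "\<lambda>n. ?k * (n * ?x n) * (?x n + p n * (1 - p n))"])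
    have "(\<lambda>n. ?k * (n * ?x n) * (?x n + p n * (1 - p n))) \<longlonglongrightarrow> ?k * l * (0 + 0)"
      by (intro tendsto_intros nx x0 pq)
    then show "(\<lambda>n. ?k * (n * ?x n) * (?x n + p n * (1 - p n))) \<longlonglongrightarrow> 0"
      by simp
    show "\<forall>\<^sub>F n in sequentially. norm (a n n - (1 - ?x n) ^ ?N n) \<le>
        norm (?k * (n * ?x n) * (?x n + p n * (1 - p n))) * 1"
    proof (rule always_eventually, rule allI)
      fix n
      have "norm (a n n - (1 - ?x n) ^ ?N n) \<le> n * (?k * ?x n * (?x n + p n * (1 - p n)))"
        using a_approx [of n n] by simp
      also have "\<dots> = ?k * (n * ?x n) * (?x n + p n * (1 - p n))"
        by simp
      finally show "norm (a n n - (1 - ?x n) ^ ?N n) \<le>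
          norm (?k * (n * ?x n) * (?x n + p n * (1 - p n))) * 1"
        by simp
    qed
  qed
  moreover have "(\<lambda>n. (1 - ?x n) ^ ?N n) \<longlonglongrightarrow> exp (- l)"
    by (rule one_minus_power_tendsto_exp [OF x_bounds x0 Nx])
  ultimately have "(\<lambda>n. (a n n - (1 - ?x n) ^ ?N n) + (1 - ?x n) ^ ?N n) \<longlonglongrightarrow> 0 + exp (- l)"
    by (rule tendsto_add)
  then have "(\<lambda>n. a n n) \<longlonglongrightarrow> exp (- l)"
    by simp
  then show ?thesis
    unfolding prob_contains_eq by (intro tendsto_intros)
qed

lemma prob_contains_tendsto_1:
  fixes p :: "nat \<Rightarrow> real"
  assumes pos: "\<exists>a\<in>set r. a > 0" and p: "\<And>n. 0 \<le> p n \<and> p n < 1"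
    and lim: "filterlim (\<lambda>n. n * ((1 - p n) ^ length r * p n ^ sum_list r)) at_top sequentially"
  shows "(\<lambda>n. prob_contains n r (p n)) \<longlonglongrightarrow> 1"
proof -
  interpret geometric_pattern n "p n" r for n
    using pos p by unfold_locales auto
  let ?x = x and ?k = "length r"
  have "filterlim (\<lambda>n. (1 / ?k) * (n * ?x n)) at_top sequentially"
    using lim k_pos by (intro filterlim_tendsto_pos_mult_at_top [OF tendsto_const]) (auto simp: x_def)
  then have "filterlim (\<lambda>n. -1 + (1 / ?k) * (n * ?x n)) at_top sequentially"
    by (rule filterlim_tendsto_add_at_top [OF tendsto_const])
  then have "filterlim (\<lambda>n. - (-1 + (1 / ?k) * (n * ?x n))) at_bot sequentially"
    by (simp only: filterlim_uminus_at_bot minus_minus)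
  then have "(\<lambda>n. exp (- (-1 + (1 / ?k) * (n * ?x n)))) \<longlonglongrightarrow> 0"
    by (rule filterlim_compose [OF exp_at_bot])
  then have e: "(\<lambda>n. exp (1 - n * ?x n / ?k)) \<longlonglongrightarrow> 0"
    by simp
  have "(\<lambda>n. a n n) \<longlonglongrightarrow> 0"
    by (rule tendsto_sandwich [OF _ _ tendsto_const e])
      (auto intro!: always_eventually a_le_exp a_nonneg)
  then have "(\<lambda>n. 1 - a n n) \<longlonglongrightarrow> 1 - 0"
    by (intro tendsto_intros)
  then show ?thesis
    by (simp add: prob_contains_eq)
qed

lemma root_scale_power:
  assumes "m > 0" "n > 0"
  shows "(real n powr (- 1 / real m)) ^ m = 1 / n"
proof -
  have "(real n powr (- 1 / real m)) ^ m = real n powr (real m * (- 1 / real m))"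
    using assms by (intro powr_power) simp
  also have "real m * (- 1 / real m) = - 1"
    using assms by simp
  finally show ?thesis
    using assms by (simp add: powr_minus inverse_eq_divide)
qed

text \<open>
  For \<open>c = 0\<close> this covers functions of smaller order than \<open>n powr (- 1 / m)\<close>, and for \<open>c > 0\<close>
  those that are asymptotic to \<open>c\<close> times it.
\<close>
lemma ratio_to_root_scale_tendsto:
  fixes f :: "nat \<Rightarrow> real"
  assumes m: "m > 0" and f: "(\<lambda>n. f n / real n powr (- 1 / real m)) \<longlonglongrightarrow> c"
  shows "f \<longlonglongrightarrow> 0" "(\<lambda>n. n * f n ^ m) \<longlonglongrightarrow> c ^ m"
proof -
  have "(\<lambda>n. real n powr (- 1 / real m)) \<longlonglongrightarrow> 0"
    using m by (intro tendsto_neg_powr filterlim_real_sequentially) simp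
  then have "(\<lambda>n. f n / real n powr (- 1 / real m) * real n powr (- 1 / real m)) \<longlonglongrightarrow> c * 0"
    by (intro tendsto_mult f)
  moreover have "\<forall>\<^sub>F n in sequentially.
      f n / real n powr (- 1 / real m) * real n powr (- 1 / real m) = f n"
    using eventually_gt_at_top [of 0] by eventually_elim simp
  ultimately show "f \<longlonglongrightarrow> 0"
    by (simp add: tendsto_cong)
  have "\<forall>\<^sub>F n in sequentially. (f n / real n powr (- 1 / real m)) ^ m = n * f n ^ m"
    using eventually_gt_at_top [of 0]
    by eventually_elim (simp only: power_divide root_scale_power [OF m], simp)
  with tendsto_power [OF f, of m] show "(\<lambda>n. n * f n ^ m) \<longlonglongrightarrow> c ^ m"
    by (simp add: tendsto_cong)
qed

lemma above_root_scale_tendsto: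
  fixes f :: "nat \<Rightarrow> real"
  assumes m: "m > 0" and f: "(\<lambda>n. real n powr (- 1 / real m)) \<in> o(f)"
  shows "(\<lambda>n. 1 / (n * f n ^ m)) \<longlonglongrightarrow> 0"
proof -
  have "(\<lambda>n. (real n powr (- 1 / real m) / f n) ^ m) \<longlonglongrightarrow> 0 ^ m"
    by (intro tendsto_power smalloD_tendsto f)
  moreover have "\<forall>\<^sub>F n in sequentially. (real n powr (- 1 / real m) / f n) ^ m = 1 / (n * f n ^ m)"
    using eventually_gt_at_top [of 0]
    by eventually_elim (simp only: power_divide root_scale_power [OF m], simp)
  ultimately have "(\<lambda>n. 1 / (n * f n ^ m)) \<longlonglongrightarrow> 0 ^ m"
    by (rule Lim_transform_eventually)
  then show ?thesis
    using m by (simp add: power_0_left)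
qed

lemma asymp_equiv_root_scale_ratio:
  fixes f :: "nat \<Rightarrow> real"
  assumes c: "c > 0" and f: "f \<sim>[sequentially] (\<lambda>n. c * real n powr e)"
  shows "(\<lambda>n. f n / real n powr e) \<longlonglongrightarrow> c"
proof -
  have "\<forall>\<^sub>F n in sequentially. f n \<noteq> 0 \<or> c * real n powr e \<noteq> 0"
    using eventually_gt_at_top [of 0] by eventually_elim (use c in simp)
  with f have "(\<lambda>n. f n / (c * real n powr e)) \<longlonglongrightarrow> 1"
    by (rule asymp_equivD_strong)
  then have "(\<lambda>n. c * (f n / (c * real n powr e))) \<longlonglongrightarrow> c * 1"
    by (intro tendsto_intros)
  then show ?thesis
    using c by simp
qed

text \<open>
  Weighted inequality of arithmetic and geometric means. The tangent bound \<open>t \<le> exp (t - 1)\<close>,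
  applied to \<open>t = (1 - y) / (1 - x)\<close> and to \<open>t = y / x\<close>, gives exponents that cancel because the
  logarithmic derivative of the left-hand side vanishes at \<open>y = x\<close>.
\<close>
lemma power_mult_power_le_maximum:
  fixes x y :: real
  assumes x: "0 < x" "x < 1" and y: "0 \<le> y" "y < 1"
    and crit: "real k * x = real m * (1 - x)"
  shows "(1 - y) ^ k * y ^ m \<le> (1 - x) ^ k * x ^ m"
proof -
  define u where "u = (1 - y) / (1 - x)"
  define v where "v = y / x"
  have uv: "0 \<le> u" "0 \<le> v"
    using x y by (auto simp: u_def v_def)
  have "u ^ k * v ^ m \<le> exp (u - 1) ^ k * exp (v - 1) ^ m"
    using uv exp_ge_add_one_self [of "u - 1"] exp_ge_add_one_self [of "v - 1"]
    by (intro mult_mono power_mono) auto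
  also have "\<dots> = exp (k * (u - 1) + m * (v - 1))"
    by (simp add: exp_add exp_of_nat_mult)
  also have "k * (u - 1) + m * (v - 1) = 0"
  proof -
    have uv: "u - 1 = (x - y) / (1 - x)" "v - 1 = (y - x) / x"
      using x by (simp_all add: u_def v_def field_simps)
    have "k * (u - 1) + m * (v - 1) = (x - y) * (real k * x - real m * (1 - x)) / (x * (1 - x))"
      unfolding uv using x by (simp add: field_simps)
    then show ?thesis
      using crit by simp
  qed
  finally have "u ^ k * v ^ m \<le> 1"
    by simp
  then show ?thesis
    using x by (simp add: u_def v_def power_divide field_simps)
qed

section \<open>The five regimes and the maximum\<close>

theorem proposition4p1:
  fixes r :: "nat list" and k m :: nat and \<alpha> :: real and p q :: "nat \<Rightarrow> real"
  assumes k: "k = length r"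
    and m: "m = sum_list r"
    and pos: "\<exists>x\<in>set r. x > 0"
    and \<alpha>: "\<alpha> > 0"
    and p: "\<And>n. 0 \<le> p n \<and> p n < 1"
    and q: "\<And>n. q n = 1 - p n"
  shows
    "(p \<in> o(\<lambda>n. real n powr (- 1 / real m)) \<longrightarrow>
        (\<lambda>n. prob_contains n r (p n)) \<longlonglongrightarrow> 0) \<and>
     (p \<sim>[sequentially] (\<lambda>n. \<alpha> * real n powr (- 1 / real m)) \<longrightarrow>
        (\<lambda>n. prob_contains n r (p n)) \<longlonglongrightarrow> 1 - exp (- (\<alpha> ^ m))) \<and>
     ((\<lambda>n. real n powr (- 1 / real m)) \<in> o(p) \<and>
      (\<lambda>n. real n powr (- 1 / real k)) \<in> o(q) \<longrightarrow>
        (\<lambda>n. prob_contains n r (p n)) \<longlonglongrightarrow> 1) \<and>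
     (q \<sim>[sequentially] (\<lambda>n. \<alpha> * real n powr (- 1 / real k)) \<longrightarrow>
        (\<lambda>n. prob_contains n r (p n)) \<longlonglongrightarrow> 1 - exp (- (\<alpha> ^ k))) \<and>
     (q \<in> o(\<lambda>n. real n powr (- 1 / real k)) \<longrightarrow>
        (\<lambda>n. prob_contains n r (p n)) \<longlonglongrightarrow> 0) \<and>
     (\<forall>n x. 0 \<le> x \<and> x < 1 \<and> x / (1 - x) = real m / real k \<longrightarrow>
        is_arg_max (expected_occurrences n r) (\<lambda>y. 0 \<le> y \<and> y < 1) x)"
proof -
  have k0: "k > 0"
    using pos k by (cases r) auto
  have m0: "m > 0"
    using pos member_le_sum_list [of _ r] m by fastforce
  have pattern: "geometric_pattern y r" if "0 \<le> y" "y < 1" for y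
    using that pos by unfold_locales
  have sparse: "(\<lambda>n. prob_contains n r (p n)) \<longlonglongrightarrow> 1 - exp (- (c ^ m))"
    if "(\<lambda>n. p n / real n powr (- 1 / real m)) \<longlonglongrightarrow> c" for c
  proof -
    note lims = ratio_to_root_scale_tendsto [OF m0 that]
    have "(\<lambda>n. p n * (1 - p n)) \<longlonglongrightarrow> 0 * (1 - 0)"
      by (intro tendsto_intros lims)
    moreover have "(\<lambda>n. (1 - p n) ^ k * (n * p n ^ m)) \<longlonglongrightarrow> (1 - 0) ^ k * c ^ m"
      by (intro tendsto_intros lims)
    ultimately show ?thesis
      using pos p by (intro prob_contains_poisson_limit) (auto simp: k m mult_ac)
  qed
  have dense: "(\<lambda>n. prob_contains n r (p n)) \<longlonglongrightarrow> 1 - exp (- (c ^ k))"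
    if "(\<lambda>n. q n / real n powr (- 1 / real k)) \<longlonglongrightarrow> c" for c
  proof -
    note lims = ratio_to_root_scale_tendsto [OF k0 that]
    have pq: "p n = 1 - q n" for n
      by (simp add: q)
    have "(\<lambda>n. (1 - q n) * q n) \<longlonglongrightarrow> (1 - 0) * 0"
      by (intro tendsto_intros lims)
    moreover have "(\<lambda>n. (1 - q n) ^ m * (n * q n ^ k)) \<longlonglongrightarrow> (1 - 0) ^ m * c ^ k"
      by (intro tendsto_intros lims)
    ultimately show ?thesis
      using pos p by (intro prob_contains_poisson_limit) (auto simp: pq k m mult_ac)
  qed
  have "(\<lambda>n. prob_contains n r (p n)) \<longlonglongrightarrow> 0" if "p \<in> o(\<lambda>n. real n powr (- 1 / real m))"
    using sparse [OF smalloD_tendsto [OF that]] m0 by (simp add: power_0_left)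
  moreover have "(\<lambda>n. prob_contains n r (p n)) \<longlonglongrightarrow> 1 - exp (- (\<alpha> ^ m))"
    if "p \<sim>[sequentially] (\<lambda>n. \<alpha> * real n powr (- 1 / real m))"
    by (rule sparse [OF asymp_equiv_root_scale_ratio [OF \<alpha> that]])
  moreover have "(\<lambda>n. prob_contains n r (p n)) \<longlonglongrightarrow> 1"
    if pm: "(\<lambda>n. real n powr (- 1 / real m)) \<in> o(p)" and qk: "(\<lambda>n. real n powr (- 1 / real k)) \<in> o(q)"
  proof -
    let ?y = "\<lambda>n. n * (q n ^ k * p n ^ m)"
    have p_pos: "\<forall>\<^sub>F n in sequentially. p n > 0"
      using landau_o.smallD [OF pm, of 1, simplified] eventually_gt_at_top [of 0]
    proof eventually_elim
      case (elim n)
      then have "p n \<noteq> 0"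
        by auto
      then show ?case
        using p [of n] by simp
    qed
    have y_pos: "\<forall>\<^sub>F n in sequentially. ?y n > 0"
      using p_pos eventually_gt_at_top [of 0]
    proof eventually_elim
      case (elim n)
      then show ?case
        using p [of n] q [of n] by simp
    qed
    have "(\<lambda>n. inverse (?y n)) \<longlonglongrightarrow> 0"
    proof (rule Lim_null_comparison)
      have "(\<lambda>n. 2 ^ k * (1 / (n * p n ^ m)) + 2 ^ m * (1 / (n * q n ^ k))) \<longlonglongrightarrow> 2 ^ k * 0 + 2 ^ m * 0"
        by (intro tendsto_intros above_root_scale_tendsto m0 k0 pm qk)
      then show "(\<lambda>n. 2 ^ k * (1 / (n * p n ^ m)) + 2 ^ m * (1 / (n * q n ^ k))) \<longlonglongrightarrow> 0"
        by simp
      show "\<forall>\<^sub>F n in sequentially.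
          norm (inverse (?y n)) \<le> 2 ^ k * (1 / (n * p n ^ m)) + 2 ^ m * (1 / (n * q n ^ k))"
        using p_pos eventually_gt_at_top [of 0]
      proof eventually_elim
        case (elim n)
        have qn: "q n > 0"
          using p [of n] q [of n] by simp
        \<comment> \<open>One of \<open>p n\<close> and \<open>q n\<close> is at least \<open>1 / 2\<close>, so its inverse power is bounded.\<close>
        have half: "inverse z ^ j \<le> 2 ^ j" if "1 / 2 \<le> z" for z :: real and j :: nat
          using that le_imp_inverse_le [of "1 / 2" z] by (intro power_mono) auto
        have "norm (inverse (?y n)) = inverse (q n) ^ k * (1 / (n * p n ^ m))"
          "norm (inverse (?y n)) = inverse (p n) ^ m * (1 / (n * q n ^ k))"
          using elim qn by (simp_all add: field_simps)
        moreover have "0 \<le> 2 ^ k * (1 / (n * p n ^ m))" "0 \<le> 2 ^ m * (1 / (n * q n ^ k))"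
          using elim qn by simp_all
        moreover have "inverse (q n) ^ k * (1 / (n * p n ^ m)) \<le> 2 ^ k * (1 / (n * p n ^ m))"
          if "1 / 2 \<le> q n"
          using elim half [OF that] by (intro mult_right_mono) auto
        moreover have "inverse (p n) ^ m * (1 / (n * q n ^ k)) \<le> 2 ^ m * (1 / (n * q n ^ k))"
          if "1 / 2 \<le> p n"
          using qn half [OF that] by (intro mult_right_mono) auto
        moreover have "1 / 2 \<le> q n \<or> 1 / 2 \<le> p n"
          using q [of n] by linarith
        ultimately show ?case
          by linarith
      qed
    qed
    then have "filterlim (\<lambda>n. inverse (inverse (?y n))) at_top sequentially"
      by (rule filterlim_inverse_at_top)
        (use y_pos in \<open>auto simp only: inverse_positive_iff_positive\<close>)
    then have "filterlim (\<lambda>n. n * ((1 - p n) ^ length r * p n ^ sum_list r)) at_top sequentially"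
      by (simp add: q k m)
    then show ?thesis
      by (rule prob_contains_tendsto_1 [OF pos p])
  qed
  moreover have "(\<lambda>n. prob_contains n r (p n)) \<longlonglongrightarrow> 1 - exp (- (\<alpha> ^ k))"
    if "q \<sim>[sequentially] (\<lambda>n. \<alpha> * real n powr (- 1 / real k))"
    by (rule dense [OF asymp_equiv_root_scale_ratio [OF \<alpha> that]])
  moreover have "(\<lambda>n. prob_contains n r (p n)) \<longlonglongrightarrow> 0" if "q \<in> o(\<lambda>n. real n powr (- 1 / real k))"
    using dense [OF smalloD_tendsto [OF that]] k0 by (simp add: power_0_left)
  moreover have "is_arg_max (expected_occurrences n r) (\<lambda>y. 0 \<le> y \<and> y < 1) x"
    if x: "0 \<le> x" "x < 1" "x / (1 - x) = real m / real k" for n x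
    unfolding is_arg_max_linorder
  proof (intro conjI allI impI)
    fix y :: real assume y: "0 \<le> y \<and> y < 1"
    have crit: "real k * x = real m * (1 - x)"
      using x k0 by (simp add: field_simps)
    then have x_pos: "0 < x"
      using x m0 by (cases "x = 0") auto
    have "(1 - y) ^ k * y ^ m \<le> (1 - x) ^ k * x ^ m"
      using x_pos x y crit by (intro power_mult_power_le_maximum) auto
    then show "expected_occurrences n r y \<le> expected_occurrences n r x"
      using geometric_pattern.expected_occurrences_eq [OF pattern, of y n]
        geometric_pattern.expected_occurrences_eq [OF pattern, of x n] x y
      by (simp add: geometric_pattern.x_def [OF pattern] k m mult_left_mono)
  qed (use x in auto)
  ultimately show ?thesis
    by blast
qed

end
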